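(* Let $X$ and $Y$ be infinite-dimensional Banach spaces over $\mathbb{C}$, where $Y=Z'$ is the dual of a normed linear space $Z$, and let $T\in B(X,Y)$. Let $(Q_n)$ be a sequence in $B(Y)$ with $\|Q_n\|\le1$ for each $n\in\mathbb{N}$, and suppose $T_n:=Q_nT$ converges to $T$ as $n\to\infty$ in the weak$^*$ sense of convergence. Then for each $k\in\mathbb{N}$, $$\lim_{n\to\infty}x_k(T_n)=x_k(T).$$
   Context: $B(X,Y)$ is the space of bounded linear operators from $X$ to $Y$ with the operator norm, $B(X)=B(X,X)$ and $X'=B(X,\mathbb{C})$. For $k\in\mathbb{N}=\{1,2,\dots\}$, $\mathcal{F}_k(X,Y)$ is the set of all finite-rank operators in $B(X,Y)$ of rank less than $k$, and the $k$-th approximation number of $T\in B(X,Y)$ is $a_k(T)=\inf\{\|T-F\| : F\in\mathcal{F}_k(X,Y)\}$. The $k$-th Weyl number of $T\in B(X,Y)$ is $x_k(T)=\sup\{a_k(TR): R\in B(\ell_2,X),\ \|R\|\le1\}$. When $Y=Z'$, a sequence $(T_n)$ in $B(X,Y)$ converges to $T$ in the weak$^*$ sense if for each $x\in X$ and $z\in Z$, $|(T_nx)(z)-(Tx)(z)|\to0$. *)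

theory Defs
  imports "HOL-Analysis.Analysis"
begin

section \<open>Complex normed spaces\<close>

text \<open>A complex normed space is a real normed space with a scalar multiplication by complex
  numbers that extends the real one and for which the norm is homogeneous.\<close>

class complex_normed_vector = real_normed_vector +
  fixes scaleC :: "complex \<Rightarrow> 'a \<Rightarrow> 'a" (infixr "*\<^sub>C" 75)
  assumes scaleC_add_right: "a *\<^sub>C (x + y) = a *\<^sub>C x + a *\<^sub>C y"
    and scaleC_add_left: "(a + b) *\<^sub>C x = a *\<^sub>C x + b *\<^sub>C x"
    and scaleC_scaleC: "a *\<^sub>C (b *\<^sub>C x) = (a * b) *\<^sub>C x"
    and scaleC_of_real: "complex_of_real r *\<^sub>C x = r *\<^sub>R x"
    and norm_scaleC: "norm (a *\<^sub>C x) = cmod a * norm x"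

class complex_banach = complex_normed_vector + complete_space

subclass (in complex_banach) banach ..

lemma scaleC_one: "1 *\<^sub>C x = (x :: 'a::complex_normed_vector)"
  using scaleC_of_real[of 1 x] by simp

global_interpretation complex_vector:
  vector_space "scaleC :: complex \<Rightarrow> 'a \<Rightarrow> 'a::complex_normed_vector"
  defines cspan = complex_vector.span
    and cdim = complex_vector.dim
  by unfold_locales (simp_all add: scaleC_add_right scaleC_add_left scaleC_scaleC scaleC_one)

definition finite_dimensional_set :: "'a::complex_normed_vector set \<Rightarrow> bool" where
  "finite_dimensional_set V \<longleftrightarrow> (\<exists>B. finite B \<and> V \<subseteq> cspan B)"

instantiation complex :: complex_normed_vector
begin
definition scaleC_complex :: "complex \<Rightarrow> complex \<Rightarrow> complex" where
  "scaleC_complex a x = a * x"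
instance
  by standard (simp_all add: scaleC_complex_def algebra_simps norm_mult scaleR_conv_of_real)
end

instance complex :: complex_banach ..


section \<open>Bounded complex-linear operators\<close>

definition bounded_clinear :: "('a::complex_normed_vector \<Rightarrow> 'b::complex_normed_vector) \<Rightarrow> bool" where
  "bounded_clinear f \<longleftrightarrow> bounded_linear f \<and> (\<forall>c x. f (c *\<^sub>C x) = c *\<^sub>C f x)"

lemma bounded_clinearD:
  assumes "bounded_clinear f"
  shows "bounded_linear f" "f (c *\<^sub>C x) = c *\<^sub>C f x"
  using assms by (auto simp: bounded_clinear_def)

lemma scaleC_zero_right: "c *\<^sub>C (0 :: 'a::complex_normed_vector) = 0"
  by (rule complex_vector.scale_zero_right)

lemma bounded_clinear_scaleC:
  fixes f :: "'a::complex_normed_vector \<Rightarrow> 'b::complex_normed_vector"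
  assumes "bounded_clinear f"
  shows "bounded_clinear (\<lambda>x. c *\<^sub>C f x)"
proof -
  interpret f: bounded_linear f using assms by (rule bounded_clinearD)
  have r: "c *\<^sub>C (r *\<^sub>R y) = r *\<^sub>R (c *\<^sub>C y)" for r and y :: 'b
    by (metis scaleC_of_real scaleC_scaleC mult.commute)
  have "bounded_linear (\<lambda>x. c *\<^sub>C f x)"
  proof (rule bounded_linear_intro)
    fix x show "norm (c *\<^sub>C f x) \<le> norm x * (cmod c * onorm f)"
      using mult_left_mono[OF onorm[OF f.bounded_linear_axioms, of x], of "cmod c"]
      by (simp add: norm_scaleC mult_ac)
  qed (simp_all add: f.add f.scaleR scaleC_add_right r)
  then show ?thesis
    using bounded_clinearD(2)[OF assms] by (simp add: bounded_clinear_def scaleC_scaleC mult.commute)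
qed

typedef (overloaded) ('a, 'b) cblinfun =
  "{f :: 'a::complex_normed_vector \<Rightarrow> 'b::complex_normed_vector. bounded_clinear f}"
  morphisms cblinfun_apply Cblinfun
  by (rule exI[of _ "\<lambda>_. 0"]) (simp add: bounded_clinear_def scaleC_zero_right)

setup_lifting type_definition_cblinfun

instantiation cblinfun :: (complex_normed_vector, complex_normed_vector) complex_normed_vector
begin

lift_definition norm_cblinfun :: "('a, 'b) cblinfun \<Rightarrow> real" is onorm .

lift_definition zero_cblinfun :: "('a, 'b) cblinfun" is "\<lambda>_. 0"
  by (simp add: bounded_clinear_def scaleC_zero_right)

lift_definition plus_cblinfun :: "('a, 'b) cblinfun \<Rightarrow> ('a, 'b) cblinfun \<Rightarrow> ('a, 'b) cblinfun"
  is "\<lambda>f g x. f x + g x"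
  by (simp add: bounded_clinear_def bounded_linear_add scaleC_add_right)

lift_definition minus_cblinfun :: "('a, 'b) cblinfun \<Rightarrow> ('a, 'b) cblinfun \<Rightarrow> ('a, 'b) cblinfun"
  is "\<lambda>f g x. f x - g x"
  by (simp add: bounded_clinear_def bounded_linear_sub complex_vector.scale_right_diff_distrib)

lift_definition uminus_cblinfun :: "('a, 'b) cblinfun \<Rightarrow> ('a, 'b) cblinfun"
  is "\<lambda>f x. - f x"
  by (simp add: bounded_clinear_def bounded_linear_minus)

lift_definition scaleC_cblinfun :: "complex \<Rightarrow> ('a, 'b) cblinfun \<Rightarrow> ('a, 'b) cblinfun"
  is "\<lambda>c f x. c *\<^sub>C f x"
  by (rule bounded_clinear_scaleC)

definition scaleR_cblinfun :: "real \<Rightarrow> ('a, 'b) cblinfun \<Rightarrow> ('a, 'b) cblinfun" where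
  "scaleR_cblinfun r f = complex_of_real r *\<^sub>C f"

definition dist_cblinfun :: "('a, 'b) cblinfun \<Rightarrow> ('a, 'b) cblinfun \<Rightarrow> real" where
  "dist_cblinfun f g = norm (f - g)"

definition sgn_cblinfun :: "('a, 'b) cblinfun \<Rightarrow> ('a, 'b) cblinfun" where
  "sgn_cblinfun f = inverse (norm f) *\<^sub>R f"

definition [code del]:
  "(uniformity :: (('a, 'b) cblinfun \<times> ('a, 'b) cblinfun) filter) =
     (INF e\<in>{0<..}. principal {(f, g). dist f g < e})"

definition open_cblinfun :: "('a, 'b) cblinfun set \<Rightarrow> bool" where
  [code del]: "open_cblinfun S \<longleftrightarrow>
     (\<forall>f\<in>S. \<forall>\<^sub>F (f', g) in uniformity. f' = f \<longrightarrow> g \<in> S)"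

instance
proof
  fix f g h :: "('a, 'b) cblinfun" and r s :: real and a b :: complex
  show "dist f g = norm (f - g)" by (rule dist_cblinfun_def)
  show "sgn f = inverse (norm f) *\<^sub>R f" by (rule sgn_cblinfun_def)
  show "(uniformity :: (('a, 'b) cblinfun \<times> ('a, 'b) cblinfun) filter) =
     (INF e\<in>{0<..}. principal {(f, g). dist f g < e})"
    by (rule uniformity_cblinfun_def)
  show "open S \<longleftrightarrow> (\<forall>f\<in>S. \<forall>\<^sub>F (f', g) in uniformity. f' = f \<longrightarrow> g \<in> S)"
    for S :: "('a, 'b) cblinfun set"
    by (rule open_cblinfun_def)
  show "f + g + h = f + (g + h)" "f + g = g + f" "0 + f = f" "- f + f = 0" "f - g = f + - g"
    by (transfer; simp add: algebra_simps fun_eq_iff)+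
  have C: "a *\<^sub>C (f + g) = a *\<^sub>C f + a *\<^sub>C g" "(a + b) *\<^sub>C f = a *\<^sub>C f + b *\<^sub>C f"
    "a *\<^sub>C (b *\<^sub>C f) = (a * b) *\<^sub>C f" "1 *\<^sub>C f = f" for a b and f g :: "('a, 'b) cblinfun"
    by (transfer; simp add: scaleC_add_right scaleC_add_left scaleC_scaleC scaleC_one)+
  then show "a *\<^sub>C (f + g) = a *\<^sub>C f + a *\<^sub>C g" "(a + b) *\<^sub>C f = a *\<^sub>C f + b *\<^sub>C f"
    "a *\<^sub>C (b *\<^sub>C f) = (a * b) *\<^sub>C f" by auto
  show "r *\<^sub>R (f + g) = r *\<^sub>R f + r *\<^sub>R g" "(r + s) *\<^sub>R f = r *\<^sub>R f + s *\<^sub>R f"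
    "r *\<^sub>R s *\<^sub>R f = (r * s) *\<^sub>R f" "1 *\<^sub>R f = f"
    by (simp_all add: scaleR_cblinfun_def C)
  show "complex_of_real r *\<^sub>C f = r *\<^sub>R f"
    by (simp add: scaleR_cblinfun_def)
  show "norm f = 0 \<longleftrightarrow> f = 0"
    by transfer (auto simp: onorm_eq_0 fun_eq_iff dest: bounded_clinearD)
  show "norm (f + g) \<le> norm f + norm g"
    by transfer (auto intro: onorm_triangle dest: bounded_clinearD)
  have le: "onorm (\<lambda>x. c *\<^sub>C f x) \<le> cmod c * onorm f" if "bounded_clinear f"
    for c and f :: "'a \<Rightarrow> 'b"
    using that
    by (intro onorm_bound)
      (auto simp: norm_scaleC mult.assoc intro!: mult_left_mono onorm onorm_pos_le
        mult_nonneg_nonneg dest: bounded_clinearD)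
  have le': "norm (c *\<^sub>C f) \<le> cmod c * norm f" for c and f :: "('a, 'b) cblinfun"
    by transfer (rule le)
  show NC: "norm (a *\<^sub>C f) = cmod a * norm f" for a and f :: "('a, 'b) cblinfun"
  proof (cases "a = 0")
    case True
    then show ?thesis
      by transfer (simp add: onorm_zero)
  next
    case False
    have "norm f = norm (inverse a *\<^sub>C (a *\<^sub>C f))"
      using False by (simp add: C)
    also have "\<dots> \<le> cmod (inverse a) * norm (a *\<^sub>C f)" by (rule le')
    finally have "norm f \<le> inverse (cmod a) * norm (a *\<^sub>C f)"
      by (simp only: norm_inverse)
    then have "cmod a * norm f \<le> norm (a *\<^sub>C f)"
      using False by (simp add: divide_simps mult.commute)
    with le'[of a f] show ?thesis by simp
  qed
  show "norm (r *\<^sub>R f) = \<bar>r\<bar> * norm f"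
    by (simp add: scaleR_cblinfun_def NC)
qed

end

lift_definition cblinfun_compose ::
  "('b::complex_normed_vector, 'c::complex_normed_vector) cblinfun \<Rightarrow>
   ('a::complex_normed_vector, 'b) cblinfun \<Rightarrow> ('a, 'c) cblinfun"
  (infixl "o\<^sub>C" 67)
  is "\<lambda>f g x. f (g x)"
  by (simp add: bounded_clinear_def bounded_linear_compose)

type_synonym 'z cdual = "('z, complex) cblinfun"

text \<open>The range space being complete, so is the space of operators; in particular every dual is
  a Banach space.\<close>

instance cblinfun :: (complex_normed_vector, complex_banach) complex_banach
proof
  fix F :: "nat \<Rightarrow> ('a, 'b) cblinfun"
  assume F: "Cauchy F"
  define G where "G n = Blinfun (cblinfun_apply (F n))" for n
  have bl: "bounded_linear (cblinfun_apply f)" for f :: "('a, 'b) cblinfun"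
    by transfer (rule bounded_clinearD)
  have G: "blinfun_apply (G n) = cblinfun_apply (F n)" for n
    by (simp add: G_def bounded_linear_Blinfun_apply bl)
  have GF: "norm (G m - G n) = norm (F m - F n)" for m n
    unfolding norm_blinfun.rep_eq norm_cblinfun.rep_eq
    by (simp add: minus_blinfun.rep_eq minus_cblinfun.rep_eq G)
  have "Cauchy G"
    using F by (simp add: Cauchy_def dist_norm GF)
  then obtain L where L: "G \<longlonglongrightarrow> L"
    by (auto simp: Cauchy_convergent_iff convergent_def)
  have ptw: "(\<lambda>n. cblinfun_apply (F n) x) \<longlonglongrightarrow> blinfun_apply L x" for x
    using blinfun.tendsto[OF L tendsto_const[of x]] by (simp add: G)
  have "blinfun_apply L (c *\<^sub>C x) = c *\<^sub>C blinfun_apply L x" for c x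
  proof (rule LIMSEQ_unique[OF ptw])
    have idc: "bounded_clinear (\<lambda>y :: 'b. y)"
      by (simp add: bounded_clinear_def)
    have "(\<lambda>n. c *\<^sub>C cblinfun_apply (F n) x) \<longlonglongrightarrow> c *\<^sub>C blinfun_apply L x"
      by (rule bounded_linear.tendsto[OF bounded_clinearD(1)[OF bounded_clinear_scaleC[OF idc]] ptw])
    moreover have "cblinfun_apply f (c *\<^sub>C x) = c *\<^sub>C cblinfun_apply f x" for f :: "('a, 'b) cblinfun"
      by transfer (rule bounded_clinearD)
    ultimately show "(\<lambda>n. cblinfun_apply (F n) (c *\<^sub>C x)) \<longlonglongrightarrow> c *\<^sub>C blinfun_apply L x"
      by simp
  qed
  then have "bounded_clinear (blinfun_apply L)"
    by (simp add: bounded_clinear_def blinfun.bounded_linear_right)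
  then have L': "cblinfun_apply (Cblinfun (blinfun_apply L)) = blinfun_apply L"
    by (simp add: Cblinfun_inverse)
  have "norm (F n - Cblinfun (blinfun_apply L)) = norm (G n - L)" for n
    unfolding norm_blinfun.rep_eq norm_cblinfun.rep_eq
    by (simp add: minus_blinfun.rep_eq minus_cblinfun.rep_eq G L')
  then have "F \<longlonglongrightarrow> Cblinfun (blinfun_apply L)"
    using L by (simp add: LIMSEQ_iff)
  then show "convergent F"
    by (rule convergentI)
qed


section \<open>The sequence space of square-summable complex sequences\<close>

lemma square_summable_add:
  fixes f g :: "nat \<Rightarrow> complex"
  assumes f: "summable (\<lambda>n. (cmod (f n))\<^sup>2)" and g: "summable (\<lambda>n. (cmod (g n))\<^sup>2)"
  shows "summable (\<lambda>n. (cmod (f n + g n))\<^sup>2)"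
    and "sqrt (\<Sum>n. (cmod (f n + g n))\<^sup>2) \<le> sqrt (\<Sum>n. (cmod (f n))\<^sup>2) + sqrt (\<Sum>n. (cmod (g n))\<^sup>2)"
proof -
  let ?K = "sqrt (\<Sum>n. (cmod (f n))\<^sup>2) + sqrt (\<Sum>n. (cmod (g n))\<^sup>2)"
  have K: "?K \<ge> 0"
    by (simp add: suminf_nonneg f g)
  have bnd: "(\<Sum>n<N. (cmod (f n + g n))\<^sup>2) \<le> ?K\<^sup>2" for N
  proof -
    have "L2_set (\<lambda>n. cmod (f n + g n)) {..<N} \<le> L2_set (\<lambda>n. cmod (f n) + cmod (g n)) {..<N}"
      by (rule L2_set_mono) (auto simp: norm_triangle_ineq)
    also have "\<dots> \<le> L2_set (\<lambda>n. cmod (f n)) {..<N} + L2_set (\<lambda>n. cmod (g n)) {..<N}"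
      by (rule L2_set_triangle_ineq)
    also have "\<dots> \<le> ?K"
      unfolding L2_set_def
      by (intro add_mono real_sqrt_le_mono sum_le_suminf f g) auto
    finally have "(L2_set (\<lambda>n. cmod (f n + g n)) {..<N})\<^sup>2 \<le> ?K\<^sup>2"
      by (intro power_mono) auto
    then show ?thesis
      by (simp add: L2_set_def sum_nonneg)
  qed
  show s: "summable (\<lambda>n. (cmod (f n + g n))\<^sup>2)"
    by (rule summableI_nonneg_bounded[OF _ bnd]) simp
  have "(\<Sum>n. (cmod (f n + g n))\<^sup>2) \<le> ?K\<^sup>2"
    by (rule suminf_le_const[OF s bnd])
  then show "sqrt (\<Sum>n. (cmod (f n + g n))\<^sup>2) \<le> ?K"
    using K by (rule real_le_lsqrt[rotated])
qed

lemma square_summable_mult: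
  fixes f :: "nat \<Rightarrow> complex"
  assumes f: "summable (\<lambda>n. (cmod (f n))\<^sup>2)"
  shows "summable (\<lambda>n. (cmod (c * f n))\<^sup>2)"
  using summable_mult[OF f, of "(cmod c)\<^sup>2"] by (simp add: norm_mult power_mult_distrib)

typedef ell2 = "{f :: nat \<Rightarrow> complex. summable (\<lambda>n. (cmod (f n))\<^sup>2)}"
  morphisms ell2_nth Ell2
  by (rule exI[of _ "\<lambda>_. 0"]) simp

setup_lifting type_definition_ell2

instantiation ell2 :: complex_normed_vector
begin

lift_definition norm_ell2 :: "ell2 \<Rightarrow> real" is "\<lambda>f. sqrt (\<Sum>n. (cmod (f n))\<^sup>2)" .

lift_definition zero_ell2 :: ell2 is "\<lambda>_. 0" by simp

lift_definition plus_ell2 :: "ell2 \<Rightarrow> ell2 \<Rightarrow> ell2" is "\<lambda>f g n. f n + g n"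
  by (rule square_summable_add)

lift_definition uminus_ell2 :: "ell2 \<Rightarrow> ell2" is "\<lambda>f n. - f n" by simp

lift_definition minus_ell2 :: "ell2 \<Rightarrow> ell2 \<Rightarrow> ell2" is "\<lambda>f g n. f n - g n"
proof -
  fix f g :: "nat \<Rightarrow> complex"
  assume "summable (\<lambda>n. (cmod (f n))\<^sup>2)" "summable (\<lambda>n. (cmod (g n))\<^sup>2)"
  then show "summable (\<lambda>n. (cmod (f n - g n))\<^sup>2)"
    using square_summable_add(1)[of f "\<lambda>n. - g n"] by simp
qed

lift_definition scaleC_ell2 :: "complex \<Rightarrow> ell2 \<Rightarrow> ell2" is "\<lambda>c f n. c * f n"
  by (rule square_summable_mult)

definition scaleR_ell2 :: "real \<Rightarrow> ell2 \<Rightarrow> ell2" where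
  "scaleR_ell2 r f = complex_of_real r *\<^sub>C f"

definition dist_ell2 :: "ell2 \<Rightarrow> ell2 \<Rightarrow> real" where
  "dist_ell2 f g = norm (f - g)"

definition sgn_ell2 :: "ell2 \<Rightarrow> ell2" where
  "sgn_ell2 f = inverse (norm f) *\<^sub>R f"

definition [code del]:
  "(uniformity :: (ell2 \<times> ell2) filter) = (INF e\<in>{0<..}. principal {(f, g). dist f g < e})"

definition open_ell2 :: "ell2 set \<Rightarrow> bool" where
  [code del]: "open_ell2 S \<longleftrightarrow> (\<forall>f\<in>S. \<forall>\<^sub>F (f', g) in uniformity. f' = f \<longrightarrow> g \<in> S)"

instance
proof
  fix f g h :: ell2 and r s :: real and a b :: complex
  show "dist f g = norm (f - g)" by (rule dist_ell2_def)
  show "sgn f = inverse (norm f) *\<^sub>R f" by (rule sgn_ell2_def)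
  show "(uniformity :: (ell2 \<times> ell2) filter) = (INF e\<in>{0<..}. principal {(f, g). dist f g < e})"
    by (rule uniformity_ell2_def)
  show "open S \<longleftrightarrow> (\<forall>f\<in>S. \<forall>\<^sub>F (f', g) in uniformity. f' = f \<longrightarrow> g \<in> S)" for S :: "ell2 set"
    by (rule open_ell2_def)
  show "f + g + h = f + (g + h)" "f + g = g + f" "0 + f = f" "- f + f = 0" "f - g = f + - g"
    by (transfer; simp add: algebra_simps fun_eq_iff)+
  have C: "a *\<^sub>C (f + g) = a *\<^sub>C f + a *\<^sub>C g" "(a + b) *\<^sub>C f = a *\<^sub>C f + b *\<^sub>C f"
    "a *\<^sub>C (b *\<^sub>C f) = (a * b) *\<^sub>C f" "1 *\<^sub>C f = f" for a b and f g :: ell2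
    by (transfer; simp add: algebra_simps)+
  then show "a *\<^sub>C (f + g) = a *\<^sub>C f + a *\<^sub>C g" "(a + b) *\<^sub>C f = a *\<^sub>C f + b *\<^sub>C f"
    "a *\<^sub>C (b *\<^sub>C f) = (a * b) *\<^sub>C f" by auto
  show "r *\<^sub>R (f + g) = r *\<^sub>R f + r *\<^sub>R g" "(r + s) *\<^sub>R f = r *\<^sub>R f + s *\<^sub>R f"
    "r *\<^sub>R s *\<^sub>R f = (r * s) *\<^sub>R f" "1 *\<^sub>R f = f"
    by (simp_all add: scaleR_ell2_def C)
  show "complex_of_real r *\<^sub>C f = r *\<^sub>R f"
    by (simp add: scaleR_ell2_def)
  show "norm f = 0 \<longleftrightarrow> f = 0"
    by transfer (auto simp: suminf_eq_zero_iff fun_eq_iff)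
  show "norm (f + g) \<le> norm f + norm g"
    by transfer (rule square_summable_add)
  show NC: "norm (a *\<^sub>C f) = cmod a * norm f" for a and f :: ell2
    by transfer (simp add: norm_mult power_mult_distrib suminf_mult real_sqrt_mult)
  show "norm (r *\<^sub>R f) = \<bar>r\<bar> * norm f"
    by (simp add: scaleR_ell2_def NC)
qed

end


section \<open>Approximation numbers and Weyl numbers\<close>

text \<open>The conjunct \<open>finite_dimensional_set\<close> is needed because \<open>cdim\<close> of an infinite-dimensional
  space is \<open>0\<close>.\<close>

definition finite_rank_less ::
    "nat \<Rightarrow> ('a::complex_normed_vector, 'b::complex_normed_vector) cblinfun set" where
  "finite_rank_less k =
     {F. finite_dimensional_set (range (cblinfun_apply F)) \<and> cdim (range (cblinfun_apply F)) < k}"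

text \<open>Both numbers below are meant for \<open>k \<ge> 1\<close> only: then the infimum is over a nonempty set
  (it contains \<open>norm T\<close>), and the supremum is over a nonempty set bounded above by \<open>norm T\<close>.\<close>

definition approximation_number ::
    "nat \<Rightarrow> ('a::complex_normed_vector, 'b::complex_normed_vector) cblinfun \<Rightarrow> real" where
  "approximation_number k T = (INF F\<in>finite_rank_less k. norm (T - F))"

definition weyl_number ::
    "nat \<Rightarrow> ('a::complex_normed_vector, 'b::complex_normed_vector) cblinfun \<Rightarrow> real" where
  "weyl_number k T =
     (SUP R \<in> {R :: (ell2, 'a) cblinfun. norm R \<le> 1}. approximation_number k (T o\<^sub>C R))"

definition weak_star_tendsto ::
    "(nat \<Rightarrow> ('a::complex_normed_vector, 'z::complex_normed_vector cdual) cblinfun) \<Rightarrow>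
     ('a, 'z cdual) cblinfun \<Rightarrow> bool" where
  "weak_star_tendsto S T \<longleftrightarrow>
     (\<forall>x z. (\<lambda>n. cmod (cblinfun_apply (cblinfun_apply (S n) x) z
                     - cblinfun_apply (cblinfun_apply T x) z)) \<longlonglongrightarrow> 0)"

end

theory Submission
  imports Defs
begin

text \<open>
  Composing with \<open>Q n\<close> does not increase approximation numbers, so \<open>weyl_number k (Q n o\<^sub>C T)\<close> is
  at most \<open>weyl_number k T\<close>; what remains is that \<open>approximation_number k\<close> is lower semicontinuous
  for weak-star convergence. If \<open>S n\<close> converges to \<open>S\<close> and \<open>S n = D n + F n\<close> with
  \<open>norm (D n) \<le> c\<close> and \<open>F n\<close> of rank less than \<open>k\<close>, then by the theorem of Banach and Alaoglu
  \<open>D n\<close> clusters at some \<open>D\<close> with \<open>norm D \<le> c\<close>. The rank of \<open>S - D\<close> is again less than \<open>k\<close>: any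
  \<open>k\<close> values of \<open>F n\<close> satisfy a linear relation whose coefficients have moduli with sum \<open>1\<close>, and
  these coefficients cluster at the coefficients of a nontrivial relation between the values of
  \<open>S - D\<close>.
\<close>

section \<open>Bounded complex-linear operators\<close>

lemma bounded_clinearI:
  assumes "\<And>x y. f (x + y) = f x + f y" "\<And>c x. f (c *\<^sub>C x) = c *\<^sub>C f x"
    and "\<And>x. norm (f x) \<le> K * norm x"
  shows "bounded_clinear f"
proof -
  have "f (r *\<^sub>R x) = r *\<^sub>R f x" for r x
    using assms(2)[of "complex_of_real r" x] by (simp add: scaleC_of_real)
  then have "bounded_linear f"
    using assms(1,3) by (intro bounded_linear_intro[where K = K]) (simp_all add: mult.commute)
  then show ?thesis using assms(2) by (simp add: bounded_clinear_def)
qed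

lemma bounded_clinear_cblinfun_apply: "bounded_clinear (cblinfun_apply f)"
  using cblinfun_apply[of f] by simp

lemma cblinfun_apply_bilinear:
  "cblinfun_apply f (x + y) = cblinfun_apply f x + cblinfun_apply f y"
  "cblinfun_apply f (x - y) = cblinfun_apply f x - cblinfun_apply f y"
  "cblinfun_apply f (c *\<^sub>C x) = c *\<^sub>C cblinfun_apply f x"
  "cblinfun_apply f 0 = 0"
  "cblinfun_apply (f + g) x = cblinfun_apply f x + cblinfun_apply g x"
  "cblinfun_apply (f - g) x = cblinfun_apply f x - cblinfun_apply g x"
  "cblinfun_apply (c *\<^sub>C f) x = c *\<^sub>C cblinfun_apply f x"
  "cblinfun_apply 0 x = 0"
  using bounded_clinearD[OF bounded_clinear_cblinfun_apply[of f]]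
  by (simp_all add: linear_simps plus_cblinfun.rep_eq minus_cblinfun.rep_eq scaleC_cblinfun.rep_eq
      zero_cblinfun.rep_eq)

lemma cblinfun_apply_sum:
  "cblinfun_apply f (\<Sum>i\<in>A. g i) = (\<Sum>i\<in>A. cblinfun_apply f (g i))"
  by (induction A rule: infinite_finite_induct) (simp_all add: cblinfun_apply_bilinear)

lemma cblinfun_sum_apply:
  "cblinfun_apply (\<Sum>i\<in>A. f i) x = (\<Sum>i\<in>A. cblinfun_apply (f i) x)"
  by (induction A rule: infinite_finite_induct) (simp_all add: cblinfun_apply_bilinear)

lemma norm_cblinfun_apply: "norm (cblinfun_apply f x) \<le> norm f * norm x"
  unfolding norm_cblinfun.rep_eq
  by (rule onorm[OF bounded_clinearD(1)[OF bounded_clinear_cblinfun_apply]])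

lemma norm_cblinfun_bound:
  assumes "0 \<le> K" "\<And>x. norm (cblinfun_apply f x) \<le> K * norm x"
  shows "norm f \<le> K"
  unfolding norm_cblinfun.rep_eq using assms by (rule onorm_bound)

lemma norm_cblinfun_compose: "norm (f o\<^sub>C g) \<le> norm f * norm g"
proof (rule norm_cblinfun_bound)
  fix x
  have "norm (cblinfun_apply f (cblinfun_apply g x)) \<le> norm f * norm (cblinfun_apply g x)"
    by (rule norm_cblinfun_apply)
  also have "\<dots> \<le> norm f * (norm g * norm x)"
    by (intro mult_left_mono norm_cblinfun_apply norm_ge_zero)
  finally show "norm (cblinfun_apply (f o\<^sub>C g) x) \<le> norm f * norm g * norm x"
    by (simp add: cblinfun_compose.rep_eq mult.assoc)
qed simp

lemma cblinfun_compose_diff_right: "f o\<^sub>C (g - h) = (f o\<^sub>C g) - (f o\<^sub>C h)"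
  by (simp add: cblinfun_apply_inject[symmetric] fun_eq_iff cblinfun_compose.rep_eq
      cblinfun_apply_bilinear)

lemma cblinfun_compose_assoc: "(f o\<^sub>C g) o\<^sub>C h = f o\<^sub>C (g o\<^sub>C h)"
  by (simp add: cblinfun_apply_inject[symmetric] fun_eq_iff cblinfun_compose.rep_eq)

section \<open>Rank as a condition on finite families\<close>

lemma card_le_of_independent_span:
  fixes B :: "'a::complex_normed_vector set"
  assumes "finite B" "complex_vector.independent C" "C \<subseteq> cspan B"
  shows "card C \<le> card B"
  using complex_vector.independent_span_bound[OF assms] by simp

text \<open>Normalising the coefficients makes the set of admissible relations compact, so that the
  condition survives pointwise limits.\<close>

lemma dim_less_iff_normalised_relation:
  fixes V :: "'a::complex_normed_vector set"
  shows "finite_dimensional_set V \<and> cdim V < k \<longleftrightarrow>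
    (\<forall>v. (\<forall>i<k. v i \<in> V) \<longrightarrow>
      (\<exists>c. (\<Sum>i<k. cmod (c i)) = 1 \<and> (\<Sum>i<k. c i *\<^sub>C v i) = 0))"
    (is "?L \<longleftrightarrow> ?R")
proof -
  obtain B where B: "B \<subseteq> V" "complex_vector.independent B" "V \<subseteq> cspan B" "card B = cdim V"
    using complex_vector.basis_exists[of V] by blast
  show ?thesis
  proof
    assume L: ?L
    \<comment> \<open>Finiteness has to come from \<open>finite_dimensional_set V\<close>: a bound
      on \<open>cdim V\<close> says nothing here, as \<open>card\<close> of an infinite set is
      0.\<close>
    have finB: "finite B"
      using L B complex_vector.independent_span_bound[of _ B]
      unfolding finite_dimensional_set_def by blast
    show ?R
    proof (intro allI impI)
      fix v :: "nat \<Rightarrow> 'a" assume v: "\<forall>i<k. v i \<in> V"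
      \<comment> \<open>If the \<open>k\<close> vectors are distinct, they outnumber
        \<open>B\<close> and are dependent; a repeated value \<open>v a = v b\<close> gives a
        relation with coefficients 1 and -1.\<close>
      obtain d j where d: "j < k" "d j \<noteq> 0" "(\<Sum>i<k. d i *\<^sub>C v i) = 0"
      proof (cases "inj_on v {..<k}")
        case True
        have "complex_vector.dependent (v ` {..<k})"
        proof (rule ccontr)
          assume "\<not> ?thesis"
          then have "card (v ` {..<k}) \<le> card B"
            using v B finB by (intro card_le_of_independent_span) auto
          then show False using L B True by (simp add: card_image)
        qed
        then obtain u where "\<exists>w\<in>v ` {..<k}. u w \<noteq> 0" "(\<Sum>w\<in>v ` {..<k}. u w *\<^sub>C w) = 0"
          by (auto simp: complex_vector.dependent_finite)
        then show ?thesis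
          using that[of _ "\<lambda>i. u (v i)"] True by (auto simp: sum.reindex)
      next
        case False
        then obtain a b where ab: "a < k" "b < k" "a \<noteq> b" "v a = v b"
          by (auto simp: inj_on_def)
        let ?d = "\<lambda>i. (if i = a then 1 else 0) - (if i = b then 1 else 0) :: complex"
        have "(\<Sum>i<k. ?d i *\<^sub>C v i) =
          (\<Sum>i<k. if i = a then v i else 0) - (\<Sum>i<k. if i = b then v i else 0)"
          unfolding sum_subtractf[symmetric]
          by (rule sum.cong) (auto simp: complex_vector.scale_left_diff_distrib scaleC_one)
        then show ?thesis
          using ab by (intro that[of a ?d]) auto
      qed
      define s where "s = (\<Sum>i<k. cmod (d i))"
      have "s > 0"
        unfolding s_def using d by (intro sum_pos2[of _ j]) auto
      then have "(\<Sum>i<k. cmod (d i / s)) = 1"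
        by (simp add: norm_divide sum_divide_distrib[symmetric] s_def[symmetric])
      moreover have "(\<Sum>i<k. (d i / s) *\<^sub>C v i) = 0"
      proof -
        have "(\<Sum>i<k. (d i / s) *\<^sub>C v i) = (1 / complex_of_real s) *\<^sub>C (\<Sum>i<k. d i *\<^sub>C v i)"
          by (simp add: complex_vector.scale_sum_right)
        then show ?thesis by (simp add: d)
      qed
      ultimately show "\<exists>c. (\<Sum>i<k. cmod (c i)) = 1 \<and> (\<Sum>i<k. c i *\<^sub>C v i) = 0"
        by (intro exI[of _ "\<lambda>i. d i / complex_of_real s"] conjI)
    qed
  next
    assume R: ?R
    \<comment> \<open>Otherwise \<open>B\<close> contains \<open>k\<close> independent vectors; they
      admit only the trivial relation, whose moduli sum to 0 instead of 1.\<close>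
    have "finite B \<and> card B < k"
    proof (rule ccontr)
      assume "\<not> ?thesis"
      then obtain C where C: "C \<subseteq> B" "finite C" "card C = k"
        by (metis infinite_arbitrarily_large leI obtain_subset_with_card_n)
      obtain v where v: "bij_betw v {..<k} C"
        using C ex_bij_betw_nat_finite[of C] by (auto simp: atLeast0LessThan)
      then have "\<forall>i<k. v i \<in> V"
        using C(1) B(1) bij_betwE[OF v] by blast
      then obtain c where c: "(\<Sum>i<k. cmod (c i)) = 1" "(\<Sum>i<k. c i *\<^sub>C v i) = 0"
        using R by blast
      define u where "u w = c (the_inv_into {..<k} v w)" for w
      have u: "u (v i) = c i" if "i < k" for i
        using v that by (simp add: u_def bij_betw_def the_inv_into_f_f)
      have "(\<Sum>w\<in>C. u w *\<^sub>C w) = (\<Sum>i<k. u (v i) *\<^sub>C v i)"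
        using sum.reindex_bij_betw[OF v, of "\<lambda>w. u w *\<^sub>C w"] by simp
      then have "(\<Sum>w\<in>C. u w *\<^sub>C w) = 0"
        using c by (simp add: u)
      then have "u w = 0" if "w \<in> C" for w
        using complex_vector.independentD[OF B(2) C(2,1) _ that] by blast
      then have "c i = 0" if "i < k" for i
        using u[OF that] v that by (auto simp: bij_betw_def)
      then show False using c(1) by simp
    qed
    then show ?L
      using B unfolding finite_dimensional_set_def by auto
  qed
qed

text \<open>The family now consists of arguments, so \<open>x\<close> can stay fixed while
  \<open>F\<close> runs through a convergent family.\<close>

lemma finite_rank_less_iff:
  fixes F :: "('a::complex_normed_vector, 'b::complex_normed_vector) cblinfun"
  shows
  "F \<in> finite_rank_less k \<longleftrightarrow>
    (\<forall>x. \<exists>c. (\<Sum>i<k. cmod (c i)) = 1 \<and> (\<Sum>i<k. c i *\<^sub>C cblinfun_apply F (x i)) = 0)"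
  unfolding finite_rank_less_def mem_Collect_eq dim_less_iff_normalised_relation
proof (intro iffI allI impI)
  fix x :: "nat \<Rightarrow> 'a"
  assume "\<forall>v. (\<forall>i<k. v i \<in> range (cblinfun_apply F)) \<longrightarrow>
    (\<exists>c. (\<Sum>i<k. cmod (c i)) = 1 \<and> (\<Sum>i<k. c i *\<^sub>C v i) = 0)"
  from this[rule_format, of "\<lambda>i. cblinfun_apply F (x i)"]
  show "\<exists>c. (\<Sum>i<k. cmod (c i)) = 1 \<and> (\<Sum>i<k. c i *\<^sub>C cblinfun_apply F (x i)) = 0"
    by simp
next
  fix v :: "nat \<Rightarrow> 'b"
  assume R: "\<forall>x. \<exists>c. (\<Sum>i<k. cmod (c i)) = 1 \<and> (\<Sum>i<k. c i *\<^sub>C cblinfun_apply F (x i)) = 0"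
    and "\<forall>i<k. v i \<in> range (cblinfun_apply F)"
  then have "\<forall>i. \<exists>y. i < k \<longrightarrow> v i = cblinfun_apply F y"
    by blast
  then obtain x where x: "\<And>i. i < k \<Longrightarrow> v i = cblinfun_apply F (x i)"
    by metis
  obtain c where "(\<Sum>i<k. cmod (c i)) = 1" "(\<Sum>i<k. c i *\<^sub>C cblinfun_apply F (x i)) = 0"
    using R by blast
  then show "\<exists>c. (\<Sum>i<k. cmod (c i)) = 1 \<and> (\<Sum>i<k. c i *\<^sub>C v i) = 0"
    by (intro exI[of _ c]) (simp add: x)
qed

text \<open>\<open>k >= 1\<close> supplies the index 0 that carries the coefficient 1. For
  \<open>k = 0\<close> the empty sum is never 1, and \<open>finite_rank_less 0\<close> is
  empty.\<close>

lemma zero_in_finite_rank_less: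
  assumes "k \<ge> 1"
  shows "(0 :: ('a::complex_normed_vector, 'b::complex_normed_vector) cblinfun) \<in> finite_rank_less k"
  unfolding finite_rank_less_iff
proof
  show "\<exists>c. (\<Sum>i<k. cmod (c i)) = 1 \<and> (\<Sum>i<k. c i *\<^sub>C cblinfun_apply 0 (x i)) = 0"
    for x :: "nat \<Rightarrow> 'a"
    using assms
    by (intro exI[of _ "\<lambda>i. if i = 0 then 1 else 0"])
      (simp add: cblinfun_apply_bilinear if_distrib[of cmod] cong: if_cong)
qed

text \<open>The linear map \<open>Q\<close> carries a relation between values of \<open>F\<close> to
  one with the same coefficients.\<close>

lemma compose_finite_rank_less:
  assumes "F \<in> finite_rank_less k"
  shows "Q o\<^sub>C F \<in> finite_rank_less k"
  unfolding finite_rank_less_iff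
proof
  fix x
  obtain c where c: "(\<Sum>i<k. cmod (c i)) = 1" "(\<Sum>i<k. c i *\<^sub>C cblinfun_apply F (x i)) = 0"
    using assms unfolding finite_rank_less_iff by blast
  have "(\<Sum>i<k. c i *\<^sub>C cblinfun_apply (Q o\<^sub>C F) (x i)) =
      cblinfun_apply Q (\<Sum>i<k. c i *\<^sub>C cblinfun_apply F (x i))"
    by (simp add: cblinfun_compose.rep_eq cblinfun_apply_sum cblinfun_apply_bilinear)
  with c show "\<exists>c. (\<Sum>i<k. cmod (c i)) = 1 \<and>
      (\<Sum>i<k. c i *\<^sub>C cblinfun_apply (Q o\<^sub>C F) (x i)) = 0"
    by (auto simp: cblinfun_apply_bilinear)
qed

section \<open>Compactness along filters\<close>

text \<open>Subfilters play the part of subnets: the compact products used below need not be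
  sequentially compact.\<close>

lemma compact_subfilter_tendsto:
  fixes f :: "'a \<Rightarrow> 'b::topological_space"
  assumes "compact K" "H \<noteq> bot" "\<forall>\<^sub>F n in H. f n \<in> K"
  obtains H' l where "H' \<noteq> bot" "H' \<le> H" "l \<in> K" "(f \<longlongrightarrow> l) H'"
proof -
  have "filtermap f H \<noteq> bot" "eventually (\<lambda>x. x \<in> K) (filtermap f H)"
    using assms by (simp_all add: filtermap_bot_iff eventually_filtermap)
  then obtain l where l: "l \<in> K" "inf (nhds l) (filtermap f H) \<noteq> bot"
    using assms(1) unfolding compact_filter by blast
  \<comment> \<open>Adding the preimages of the neighbourhoods of the cluster point \<open>l\<close>
    to \<open>H\<close> forces convergence. The result is proper because \<open>f\<close> enters
    each such neighbourhood frequently along \<open>H\<close>.\<close>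
  let ?H = "inf (filtercomap f (nhds l)) H"
  have "?H \<noteq> bot"
  proof
    assume "?H = bot"
    then have "eventually (\<lambda>_. False) ?H" by simp
    then obtain P R where PR: "eventually P (filtercomap f (nhds l))" "eventually R H"
      "\<And>n. P n \<Longrightarrow> R n \<Longrightarrow> False"
      unfolding eventually_inf by blast
    then obtain P' where P': "eventually P' (nhds l)" "\<And>n. P' (f n) \<Longrightarrow> P n"
      unfolding eventually_filtercomap by blast
    have "eventually (\<lambda>y. \<not> P' y) (filtermap f H)"
      unfolding eventually_filtermap using PR(2) by eventually_elim (use PR P' in blast)
    with P'(1) have "eventually (\<lambda>_. False) (inf (nhds l) (filtermap f H))"
      unfolding eventually_inf by blast
    with l(2) show False by (simp add: trivial_limit_def)
  qed
  moreover have "(f \<longlongrightarrow> l) ?H"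
    by (rule tendsto_mono[OF inf_le1 filterlim_filtercomap])
  ultimately show ?thesis using that l(1) inf_le2 by blast
qed

text \<open>Tychonoff's theorem, carried over from the product topology to the topology of the
  function type.\<close>

lemma compact_Pi_UNIV:
  fixes K :: "'i \<Rightarrow> 'b::topological_space set"
  assumes "\<And>i. compact (K i)"
  shows "compact {f. \<forall>i. f i \<in> K i}"
proof -
  have "compactin (product_topology (\<lambda>_. euclidean) UNIV) (PiE UNIV K)"
    using assms by (simp add: compactin_PiE)
  moreover have "PiE UNIV K = {f. \<forall>i. f i \<in> K i}" by auto
  ultimately show ?thesis
    by (simp add: euclidean_product_topology)
qed

text \<open>The values lie in a compact product of closed discs, and evaluation at a coordinate is
  continuous. This serves both for operators and for the coefficients of relations.\<close>

lemma pointwise_bounded_subfilter_tendsto: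
  fixes f :: "'n \<Rightarrow> 'i \<Rightarrow> complex"
  assumes "H \<noteq> bot" "\<forall>\<^sub>F n in H. \<forall>i. cmod (f n i) \<le> r i"
  obtains H' l where "H' \<noteq> bot" "H' \<le> H" "\<And>i. ((\<lambda>n. f n i) \<longlongrightarrow> l i) H'"
proof -
  have K: "compact {g :: 'i \<Rightarrow> complex. \<forall>i. g i \<in> cball 0 (r i)}"
    by (rule compact_Pi_UNIV) simp
  have f: "\<forall>\<^sub>F n in H. f n \<in> {g :: 'i \<Rightarrow> complex. \<forall>i. g i \<in> cball 0 (r i)}"
    using assms(2) by simp
  obtain H' l where H': "H' \<noteq> bot" "H' \<le> H" and l: "(f \<longlongrightarrow> l) H'"
    using compact_subfilter_tendsto[OF K assms(1) f] by blast
  have "((\<lambda>n. f n i) \<longlongrightarrow> l i) H'" for i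
    by (rule continuous_on_tendsto_compose[OF continuous_on_product_coordinates l]) auto
  with H' show ?thesis by (rule that)
qed

section \<open>Weak-star limits of operators into a dual space\<close>

text \<open>The operators are treated as bilinear forms on pairs \<open>(x, z)\<close>, bounded by
  \<open>c * norm x * norm z\<close>. A pointwise limit of such forms is bilinear with the same
  bound, hence comes from an operator.\<close>

lemma banach_alaoglu_cdual_operators:
  fixes D :: "'n \<Rightarrow> ('a::complex_normed_vector, 'z::complex_normed_vector cdual) cblinfun"
  assumes "H \<noteq> bot" "\<forall>\<^sub>F n in H. norm (D n) \<le> c" "c \<ge> 0"
  obtains H' L where "H' \<noteq> bot" "H' \<le> H" "norm L \<le> c"
    "\<And>x z. ((\<lambda>n. cblinfun_apply (cblinfun_apply (D n) x) z) \<longlongrightarrow>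
        cblinfun_apply (cblinfun_apply L x) z) H'"
proof -
  let ?f = "\<lambda>n p. cblinfun_apply (cblinfun_apply (D n) (fst p)) (snd p)"
  have "\<forall>\<^sub>F n in H. \<forall>p. cmod (?f n p) \<le> c * norm (fst p) * norm (snd p)"
    using assms(2)
  proof (eventually_elim, intro allI)
    fix n and p :: "'a \<times> 'z"
    assume n: "norm (D n) \<le> c"
    have "cmod (?f n p) \<le> norm (cblinfun_apply (D n) (fst p)) * norm (snd p)"
      by (rule norm_cblinfun_apply)
    also have "\<dots> \<le> norm (D n) * norm (fst p) * norm (snd p)"
      by (intro mult_right_mono norm_cblinfun_apply norm_ge_zero)
    also have "\<dots> \<le> c * norm (fst p) * norm (snd p)"
      by (intro mult_right_mono n norm_ge_zero)
    finally show "cmod (?f n p) \<le> c * norm (fst p) * norm (snd p)" .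
  qed
  note bound = this
  obtain H' l where H': "H' \<noteq> bot" "H' \<le> H" and lim: "\<And>p. ((\<lambda>n. ?f n p) \<longlongrightarrow> l p) H'"
    using pointwise_bounded_subfilter_tendsto[OF assms(1) bound] by blast
  \<comment> \<open>Uniqueness of limits turns each linearity identity of the forms into one for
    \<open>l\<close>.\<close>
  have uniq: "l p = w" if "((\<lambda>n. ?f n p) \<longlongrightarrow> w) H'" for p w
    using tendsto_unique[OF H'(1) lim that] .
  have l_bound: "cmod (l (x, z)) \<le> c * norm x * norm z" for x z
  proof (rule tendsto_upperbound[OF tendsto_norm[OF lim] _ H'(1)])
    show "\<forall>\<^sub>F n in H'. cmod (?f n (x, z)) \<le> c * norm x * norm z"
      using filter_leD[OF H'(2) bound] by (rule eventually_mono) (metis fst_conv snd_conv)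
  qed
  have add_right: "l (x, y + z) = l (x, y) + l (x, z)" for x y z
    using tendsto_add[OF lim[of "(x, y)"] lim[of "(x, z)"]]
    by (intro uniq) (simp add: cblinfun_apply_bilinear)
  have scale_right: "l (x, a *\<^sub>C z) = a *\<^sub>C l (x, z)" for a x z
    using tendsto_mult_left[OF lim[of "(x, z)"], of a]
    by (intro uniq) (simp add: cblinfun_apply_bilinear scaleC_complex_def)
  have add_left: "l (x + y, z) = l (x, z) + l (y, z)" for x y z
    using tendsto_add[OF lim[of "(x, z)"] lim[of "(y, z)"]]
    by (intro uniq) (simp add: cblinfun_apply_bilinear)
  have scale_left: "l (a *\<^sub>C x, z) = a *\<^sub>C l (x, z)" for a x z
    using tendsto_mult_left[OF lim[of "(x, z)"], of a]
    by (intro uniq) (simp add: cblinfun_apply_bilinear scaleC_complex_def)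
  \<comment> \<open>Currying the scalar form \<open>l\<close> gives a map into the dual.\<close>
  define g where "g x = Cblinfun (\<lambda>z. l (x, z))" for x
  have g: "cblinfun_apply (g x) z = l (x, z)" for x z
    unfolding g_def
    by (subst Cblinfun_inverse)
      (auto intro!: bounded_clinearI[where K = "c * norm x"] add_right scale_right l_bound)
  have g_norm: "norm (g x) \<le> c * norm x" for x
    using assms(3) l_bound by (intro norm_cblinfun_bound) (simp_all add: g)
  have "bounded_clinear g"
    by (rule bounded_clinearI[OF _ _ g_norm])
      (simp_all add: cblinfun_apply_inject[symmetric] fun_eq_iff g cblinfun_apply_bilinear
        add_left scale_left)
  then have L: "cblinfun_apply (Cblinfun g) = g"
    by (simp add: Cblinfun_inverse)
  show ?thesis
  proof (rule that[OF H', of "Cblinfun g"])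
    show "norm (Cblinfun g) \<le> c"
      by (rule norm_cblinfun_bound[OF assms(3)]) (simp add: L g_norm)
  qed (use lim in \<open>force simp: L g\<close>)
qed

text \<open>The coefficients of the relations vary with \<open>n\<close>, but their moduli are at
  most 1, so they converge along a further subfilter.\<close>

lemma finite_rank_less_weak_star_limit:
  fixes F :: "'n \<Rightarrow> ('a::complex_normed_vector, 'z::complex_normed_vector cdual) cblinfun"
  assumes "H \<noteq> bot" and F: "\<forall>\<^sub>F n in H. F n \<in> finite_rank_less k"
    and lim: "\<And>x z. ((\<lambda>n. cblinfun_apply (cblinfun_apply (F n) x) z) \<longlongrightarrow>
        cblinfun_apply (cblinfun_apply L x) z) H"
  shows "L \<in> finite_rank_less k"
  unfolding finite_rank_less_iff
proof
  fix x :: "nat \<Rightarrow> 'a"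
  let ?P = "\<lambda>n c. (\<Sum>i<k. cmod (c i)) = 1 \<and> (\<Sum>i<k. c i *\<^sub>C cblinfun_apply (F n) (x i)) = 0"
  define c where "c n = (SOME c. ?P n c)" for n
  have c: "?P n (c n)" if "F n \<in> finite_rank_less k" for n
  proof -
    have "\<exists>c. ?P n c"
      using that unfolding finite_rank_less_iff by (rule spec)
    then show ?thesis unfolding c_def by (rule someI_ex[of "?P n"])
  qed
  \<comment> \<open>For \<open>i >= k\<close> nothing constrains \<open>c n i\<close>; putting 0
    there makes the bound hold for every index.\<close>
  have "\<forall>\<^sub>F n in H. \<forall>i. cmod (if i < k then c n i else 0) \<le> 1"
    using F
  proof (eventually_elim, intro allI)
    fix n i
    assume "F n \<in> finite_rank_less k"
    then show "cmod (if i < k then c n i else 0) \<le> 1"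
      using c[of n] member_le_sum[of i "{..<k}" "\<lambda>i. cmod (c n i)"] by auto
  qed
  then obtain H' l where H': "H' \<noteq> bot" "H' \<le> H"
    and lim': "\<And>i. ((\<lambda>n. if i < k then c n i else 0) \<longlongrightarrow> l i) H'"
    using pointwise_bounded_subfilter_tendsto[OF assms(1),
        of "\<lambda>n i. if i < k then c n i else 0" "\<lambda>_. 1"] by blast
  have l: "((\<lambda>n. c n i) \<longlongrightarrow> l i) H'" if "i < k" for i
    using lim'[of i] that by simp
  have F': "\<forall>\<^sub>F n in H'. ?P n (c n)"
    using filter_leD[OF H'(2) F] by (rule eventually_mono) (rule c)
  \<comment> \<open>The normalisation passes to the limit and keeps the limiting relation
    nontrivial.\<close>
  have "((\<lambda>n. \<Sum>i<k. cmod (c n i)) \<longlongrightarrow> (\<Sum>i<k. cmod (l i))) H'"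
    by (intro tendsto_sum tendsto_norm l) simp
  moreover have "((\<lambda>n. \<Sum>i<k. cmod (c n i)) \<longlongrightarrow> 1) H'"
    using F' by (intro tendsto_eventually) (auto elim: eventually_mono)
  ultimately have "(\<Sum>i<k. cmod (l i)) = 1"
    using tendsto_unique[OF H'(1)] by blast
  moreover have "(\<Sum>i<k. l i *\<^sub>C cblinfun_apply L (x i)) = 0"
  proof -
    \<comment> \<open>Convergence of \<open>F n\<close> is known only after evaluation at each
      \<open>z\<close>, where the relation becomes one between scalars.\<close>
    have "(\<Sum>i<k. l i * cblinfun_apply (cblinfun_apply L (x i)) z) = 0" for z
    proof -
      let ?s = "\<lambda>n. \<Sum>i<k. c n i * cblinfun_apply (cblinfun_apply (F n) (x i)) z"
      have "(?s \<longlongrightarrow> (\<Sum>i<k. l i * cblinfun_apply (cblinfun_apply L (x i)) z)) H'"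
        by (intro tendsto_sum tendsto_mult l tendsto_mono[OF H'(2) lim]) simp
      moreover have "\<forall>\<^sub>F n in H'. ?s n = 0"
        using F'
      proof eventually_elim
        fix n assume "?P n (c n)"
        then have "cblinfun_apply (\<Sum>i<k. c n i *\<^sub>C cblinfun_apply (F n) (x i)) z = 0"
          by (simp add: cblinfun_apply_bilinear)
        then show "?s n = 0"
          by (simp add: cblinfun_sum_apply cblinfun_apply_bilinear scaleC_complex_def)
      qed
      then have "(?s \<longlongrightarrow> 0) H'"
        by (rule tendsto_eventually)
      ultimately show ?thesis
        using tendsto_unique[OF H'(1)] by blast
    qed
    then show ?thesis
      by (simp add: cblinfun_apply_inject[symmetric] fun_eq_iff cblinfun_sum_apply
          cblinfun_apply_bilinear scaleC_complex_def)
  qed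
  ultimately show "\<exists>c. (\<Sum>i<k. cmod (c i)) = 1 \<and> (\<Sum>i<k. c i *\<^sub>C cblinfun_apply L (x i)) = 0"
    by blast
qed

section \<open>Approximation and Weyl numbers\<close>

lemma approximation_number_le:
  assumes "F \<in> finite_rank_less k"
  shows "approximation_number k T \<le> norm (T - F)"
  unfolding approximation_number_def
  using assms by (intro cINF_lower bdd_belowI[where m = 0]) auto

lemma approximation_number_lessE:
  fixes T :: "('a::complex_normed_vector, 'b::complex_normed_vector) cblinfun"
  assumes "k \<ge> 1" "approximation_number k T < c"
  obtains F where "F \<in> finite_rank_less k" "norm (T - F) < c"
proof -
  have "finite_rank_less k \<noteq> ({} :: ('a, 'b) cblinfun set)"
    using zero_in_finite_rank_less[OF assms(1)] by blast
  then have "\<not> (\<forall>F\<in>finite_rank_less k. c \<le> norm (T - F))"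
    using assms(2) cINF_greatest[of "finite_rank_less k" c "\<lambda>F. norm (T - F)"]
    unfolding approximation_number_def by force
  then show ?thesis using that by force
qed

lemma approximation_number_le_norm:
  assumes "k \<ge> 1"
  shows "approximation_number k T \<le> norm T"
  using approximation_number_le[OF zero_in_finite_rank_less[OF assms], of T] by simp

text \<open>If \<open>F\<close> approximates \<open>T\<close>, then \<open>Q o\<^sub>C F\<close>
  approximates \<open>Q o\<^sub>C T\<close> at least as well and still has rank less than
  \<open>k\<close>.\<close>

lemma approximation_number_compose_le:
  assumes "k \<ge> 1" "norm Q \<le> 1"
  shows "approximation_number k (Q o\<^sub>C T) \<le> approximation_number k T"
proof (rule ccontr)
  assume "\<not> ?thesis"
  then obtain F where F: "F \<in> finite_rank_less k" "norm (T - F) < approximation_number k (Q o\<^sub>C T)"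
    using approximation_number_lessE[OF assms(1)] by (metis not_le)
  have "approximation_number k (Q o\<^sub>C T) \<le> norm (Q o\<^sub>C (T - F))"
    unfolding cblinfun_compose_diff_right
    by (rule approximation_number_le[OF compose_finite_rank_less[OF F(1)]])
  also have "\<dots> \<le> norm Q * norm (T - F)"
    by (rule norm_cblinfun_compose)
  also have "\<dots> \<le> norm (T - F)"
    using assms(2) by (simp add: mult_left_le_one_le)
  finally show False using F(2) by simp
qed

lemma approximation_number_weak_star_lsc:
  fixes T :: "('a::complex_normed_vector, 'z::complex_normed_vector cdual) cblinfun"
  assumes "k \<ge> 1" "weak_star_tendsto S T" "c < approximation_number k T"
  shows "\<forall>\<^sub>F n in sequentially. c \<le> approximation_number k (S n)"
proof (rule ccontr)
  assume "\<not> ?thesis"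
  then have freq: "\<exists>\<^sub>F n in sequentially. approximation_number k (S n) < c"
    by (simp add: not_eventually not_le)
  define A where "A = {n. approximation_number k (S n) < c}"
  \<comment> \<open>Along \<open>H\<close> every index eventually admits an approximant within
    \<open>c\<close>.\<close>
  define H where "H = inf sequentially (principal A)"
  have H: "H \<noteq> bot" "H \<le> sequentially" and HA: "\<forall>\<^sub>F n in H. n \<in> A"
    using freq by (auto simp: H_def A_def trivial_limit_def eventually_inf_principal frequently_def)
  have "\<exists>F. n \<in> A \<longrightarrow> F \<in> finite_rank_less k \<and> norm (S n - F) < c" for n
    using approximation_number_lessE[OF assms(1), of "S n" c] unfolding A_def mem_Collect_eq by blast
  then obtain F where F: "\<And>n. n \<in> A \<Longrightarrow> F n \<in> finite_rank_less k \<and> norm (S n - F n) < c"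
    by metis
  have SF: "\<forall>\<^sub>F n in H. norm (S n - F n) \<le> c"
    using HA by eventually_elim (use F in force)
  have "c \<ge> 0"
  proof -
    obtain n where "n \<in> A"
      using frequently_ex[OF freq] unfolding A_def by blast
    then show ?thesis using F[of n] norm_ge_zero[of "S n - F n"] by linarith
  qed
  then obtain H' D where H': "H' \<noteq> bot" "H' \<le> H" and D: "norm D \<le> c"
    and lim: "\<And>x z. ((\<lambda>n. cblinfun_apply (cblinfun_apply (S n - F n) x) z) \<longlongrightarrow>
      cblinfun_apply (cblinfun_apply D x) z) H'"
    using banach_alaoglu_cdual_operators[OF H(1) SF] by blast
  \<comment> \<open>Along \<open>H'\<close>, \<open>F n\<close> is \<open>S n\<close> minus
    \<open>S n - F n\<close> and so tends to \<open>T - D\<close>; this approximates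
    \<open>T\<close> with error \<open>norm D <= c\<close>.\<close>
  have "T - D \<in> finite_rank_less k"
  proof (rule finite_rank_less_weak_star_limit[OF H'(1)])
    show "\<forall>\<^sub>F n in H'. F n \<in> finite_rank_less k"
      using filter_leD[OF H'(2) HA] by eventually_elim (use F in blast)
    fix x z
    have "(\<lambda>n. cblinfun_apply (cblinfun_apply (S n) x) z) \<longlonglongrightarrow> cblinfun_apply (cblinfun_apply T x) z"
      using assms(2)[unfolded weak_star_tendsto_def, rule_format, of x z]
      by (rule LIM_zero_cancel[OF tendsto_norm_zero_cancel])
    then have "((\<lambda>n. cblinfun_apply (cblinfun_apply (S n) x) z) \<longlongrightarrow>
        cblinfun_apply (cblinfun_apply T x) z) H'"
      by (rule tendsto_mono[OF order_trans[OF H'(2) H(2)]])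
    from tendsto_diff[OF this lim[of x z]]
    show "((\<lambda>n. cblinfun_apply (cblinfun_apply (F n) x) z) \<longlongrightarrow>
        cblinfun_apply (cblinfun_apply (T - D) x) z) H'"
      by (simp add: cblinfun_apply_bilinear)
  qed
  then have "approximation_number k T \<le> norm (T - (T - D))"
    by (rule approximation_number_le)
  with D assms(3) show False by simp
qed

section \<open>Weyl numbers and their limit\<close>

text \<open>The real supremum is an upper bound only for a bounded family; here
  \<open>norm T\<close> bounds it.\<close>

lemma approximation_number_le_weyl_number:
  fixes R :: "(ell2, 'a::complex_normed_vector) cblinfun"
  assumes "k \<ge> 1" "norm R \<le> 1"
  shows "approximation_number k (T o\<^sub>C R) \<le> weyl_number k T"
  unfolding weyl_number_def
proof (rule cSUP_upper)
  show "bdd_above ((\<lambda>R. approximation_number k (T o\<^sub>C R)) ` {R :: (ell2, 'a) cblinfun. norm R \<le> 1})"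
  proof (rule bdd_aboveI2)
    fix R :: "(ell2, 'a) cblinfun"
    assume "R \<in> {R. norm R \<le> 1}"
    then have "norm T * norm R \<le> norm T"
      by (simp add: mult_left_le)
    then show "approximation_number k (T o\<^sub>C R) \<le> norm T"
      using approximation_number_le_norm[OF assms(1)] norm_cblinfun_compose
      by (meson order_trans)
  qed
qed (use assms in simp)

lemma weyl_number_compose_le:
  assumes "k \<ge> 1" "norm Q \<le> 1"
  shows "weyl_number k (Q o\<^sub>C T) \<le> weyl_number k T"
  unfolding weyl_number_def[of k "Q o\<^sub>C T"]
proof (rule cSUP_least)
  show "{R. norm R \<le> 1} \<noteq> {}"
    by (auto intro: exI[of _ 0])
qed (use approximation_number_compose_le[OF assms] approximation_number_le_weyl_number[OF assms(1)]
  in \<open>auto simp: cblinfun_compose_assoc intro: order_trans\<close>)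

theorem theorem8:
  fixes T :: "('x::complex_banach, 'z::complex_normed_vector cdual) cblinfun"
    and Q :: "nat \<Rightarrow> ('z cdual, 'z cdual) cblinfun"
    and k :: nat
  assumes "\<not> finite_dimensional_set (UNIV :: 'x set)"
    and "\<not> finite_dimensional_set (UNIV :: 'z cdual set)"
    and "\<And>n. n \<ge> 1 \<Longrightarrow> norm (Q n) \<le> 1"
    and "weak_star_tendsto (\<lambda>n. Q n o\<^sub>C T) T"
    and "k \<ge> 1"
  shows "(\<lambda>n. weyl_number k (Q n o\<^sub>C T)) \<longlonglongrightarrow> weyl_number k T"
proof (rule order_tendstoI)
  fix a assume "weyl_number k T < a"
  then show "\<forall>\<^sub>F n in sequentially. weyl_number k (Q n o\<^sub>C T) < a"
    \<comment> \<open>The threshold is 1 because \<open>norm (Q 0)\<close> is unconstrained.\<close>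
    by (intro eventually_sequentiallyI[of 1])
      (rule order_le_less_trans[OF weyl_number_compose_le[OF assms(5) assms(3)]])
next
  fix a assume "a < weyl_number k T"
  \<comment> \<open>Semicontinuity will give only a non-strict bound by \<open>c\<close>, so room is
    left above \<open>a\<close>.\<close>
  then obtain c where c: "a < c" "c < weyl_number k T"
    using dense by blast
  have "{R :: (ell2, 'x) cblinfun. norm R \<le> 1} \<noteq> {}"
    by (auto intro: exI[of _ 0])
  \<comment> \<open>One \<open>R\<close> with value above \<open>c\<close> suffices: semicontinuity
    is applied to \<open>T o\<^sub>C R\<close> alone, and no uniformity in \<open>R\<close> is
    needed.\<close>
  then obtain R :: "(ell2, 'x) cblinfun"
    where R: "norm R \<le> 1" "c < approximation_number k (T o\<^sub>C R)"
    using c(2) cSUP_least[of "{R :: (ell2, 'x) cblinfun. norm R \<le> 1}"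
        "\<lambda>R. approximation_number k (T o\<^sub>C R)" c]
    unfolding weyl_number_def by (metis (mono_tags, lifting) mem_Collect_eq not_le)
  have "weak_star_tendsto (\<lambda>n. Q n o\<^sub>C T o\<^sub>C R) (T o\<^sub>C R)"
    using assms(4) by (simp add: weak_star_tendsto_def cblinfun_compose.rep_eq)
  then have "\<forall>\<^sub>F n in sequentially. c \<le> approximation_number k (Q n o\<^sub>C T o\<^sub>C R)"
    using R(2) by (rule approximation_number_weak_star_lsc[OF assms(5)])
  then show "\<forall>\<^sub>F n in sequentially. a < weyl_number k (Q n o\<^sub>C T)"
    by (rule eventually_mono)
      (use c(1) approximation_number_le_weyl_number[OF assms(5) R(1)] in \<open>meson less_le_trans\<close>)
qed

end
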